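(* Let $M$ be an oriented surface in $\mathbb{E}^3$, let $\gamma$ be a unit speed curve on $M$, and let $\overline{\gamma}$ be the $\mathsf{V}$-direction curve of $\gamma$. Then $\gamma$ is a relatively normal-slant helix if and only if $\overline{\gamma}$ is a general helix.
   Context: $\mathbb{E}^3$ is Euclidean 3-space. For a unit speed curve $\gamma$ (with arc-length parameter $s$) on an oriented surface $M\subset\mathbb{E}^3$, the Darboux frame along $\gamma$ is $\{\mathsf{T},\mathsf{V},\mathsf{U}\}$, where $\mathsf{T}=\gamma'$ is the unit tangent vector field of $\gamma$, $\mathsf{U}$ is the unit normal vector field of $M$ restricted to $\gamma$, and $\mathsf{V}=\mathsf{U}\times\mathsf{T}$. The curve $\gamma$ is called a relatively normal-slant helix if its vector field $\mathsf{V}$ makes a constant angle with a fixed direction, i.e. there exist a fixed unit vector $d$ and a constant angle $\theta$ such that $\langle\mathsf{V},d\rangle=\cos\theta$ along $\gamma$. A curve $\overline{\gamma}$ lying on $M$ is called a $\mathsf{V}$-direction curve of $\gamma$ if it is the integral curve of the vector field $\mathsf{V}$; in other words, if $\overline{\gamma}$ is the $\mathsf{V}$-direction curve of $\gamma$, then $\overline{\gamma}'(s)=\mathsf{V}(s)$. A general helix (generalized helix) is a space curve whose tangent vector makes a constant angle with a fixed direction. *)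

theory Defs
  imports "HOL-Analysis.Analysis"
begin

text \<open>
  Intended for open \<open>S\<close>.  The \<open>(k+1)\<close>-st level iterates over the directional derivatives of \<open>f\<close>, so
  that the codomain does not change with \<open>k\<close>; on a Euclidean domain this is the usual class of
  \<open>k\<close> times continuously differentiable functions.
\<close>

primrec Ck_on :: "nat \<Rightarrow> 'a::euclidean_space set \<Rightarrow> ('a \<Rightarrow> 'b::real_normed_vector) \<Rightarrow> bool" where
  "Ck_on 0 S f \<longleftrightarrow> continuous_on S f"
| "Ck_on (Suc k) S f \<longleftrightarrow>
     (\<forall>x\<in>S. f differentiable (at x)) \<and> (\<forall>v. Ck_on k S (\<lambda>x. frechet_derivative f (at x) v))"

definition smooth_on :: "'a::euclidean_space set \<Rightarrow> ('a \<Rightarrow> 'b::real_normed_vector) \<Rightarrow> bool" where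
  "smooth_on S f \<longleftrightarrow> (\<forall>k. Ck_on k S f)"

definition regular_surface :: "(real^3) set \<Rightarrow> bool" where
  "regular_surface M \<longleftrightarrow>
     (\<forall>p\<in>M. \<exists>(A :: (real^2) set) (W :: (real^3) set) \<phi> \<psi>.
        open A \<and> open W \<and> p \<in> W \<and>
        smooth_on A \<phi> \<and> homeomorphism A (M \<inter> W) \<phi> \<psi> \<and>
        (\<forall>u\<in>A. inj (frechet_derivative \<phi> (at u))))"

definition tangent_space :: "(real^3) set \<Rightarrow> real^3 \<Rightarrow> (real^3) set" where
  "tangent_space M p =
     {v. \<exists>\<epsilon>>0. \<exists>\<alpha> :: real \<Rightarrow> real^3.
        smooth_on {-\<epsilon><..<\<epsilon>} \<alpha> \<and> \<alpha> ` {-\<epsilon><..<\<epsilon>} \<subseteq> M \<and> \<alpha> 0 = p \<and>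
        (\<alpha> has_vector_derivative v) (at 0)}"

text \<open>
  The orientation is given by the unit normal field \<open>N\<close>; a continuous unit normal field on a smooth
  surface is automatically smooth.  Values of \<open>N\<close> off \<open>M\<close> are irrelevant.
\<close>

definition oriented_surface :: "(real^3) set \<Rightarrow> (real^3 \<Rightarrow> real^3) \<Rightarrow> bool" where
  "oriented_surface M N \<longleftrightarrow>
     regular_surface M \<and> continuous_on M N \<and>
     (\<forall>p\<in>M. norm (N p) = 1 \<and> (\<forall>v\<in>tangent_space M p. N p \<bullet> v = 0))"

definition regular_curve :: "real set \<Rightarrow> (real \<Rightarrow> real^3) \<Rightarrow> bool" where
  "regular_curve I c \<longleftrightarrow>
     open I \<and> is_interval I \<and> I \<noteq> {} \<and> smooth_on I c \<and>
     (\<forall>s\<in>I. vector_derivative c (at s) \<noteq> 0)"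

definition unit_speed_curve :: "real set \<Rightarrow> (real \<Rightarrow> real^3) \<Rightarrow> bool" where
  "unit_speed_curve I c \<longleftrightarrow>
     regular_curve I c \<and> (\<forall>s\<in>I. norm (vector_derivative c (at s)) = 1)"

definition unit_tangent :: "(real \<Rightarrow> real^3) \<Rightarrow> real \<Rightarrow> real^3" where
  "unit_tangent c s = vector_derivative c (at s) /\<^sub>R norm (vector_derivative c (at s))"

text \<open>The Darboux frame of a unit speed curve \<open>\<gamma>\<close> on the surface oriented by \<open>N\<close>.\<close>

definition darboux_T :: "(real \<Rightarrow> real^3) \<Rightarrow> real \<Rightarrow> real^3" where
  "darboux_T \<gamma> s = vector_derivative \<gamma> (at s)"

definition darboux_U :: "(real^3 \<Rightarrow> real^3) \<Rightarrow> (real \<Rightarrow> real^3) \<Rightarrow> real \<Rightarrow> real^3" where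
  "darboux_U N \<gamma> s = N (\<gamma> s)"

definition darboux_V :: "(real^3 \<Rightarrow> real^3) \<Rightarrow> (real \<Rightarrow> real^3) \<Rightarrow> real \<Rightarrow> real^3" where
  "darboux_V N \<gamma> s = cross3 (darboux_U N \<gamma> s) (darboux_T \<gamma> s)"

text \<open>For a field \<open>X\<close> of unit vectors.\<close>

definition constant_angle_on :: "real set \<Rightarrow> (real \<Rightarrow> real^3) \<Rightarrow> bool" where
  "constant_angle_on I X \<longleftrightarrow>
     (\<exists>d \<theta>. norm d = 1 \<and> (\<forall>s\<in>I. X s \<bullet> d = cos \<theta>))"

definition relatively_normal_slant_helix ::
    "real set \<Rightarrow> (real^3 \<Rightarrow> real^3) \<Rightarrow> (real \<Rightarrow> real^3) \<Rightarrow> bool" where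
  "relatively_normal_slant_helix I N \<gamma> \<longleftrightarrow> constant_angle_on I (darboux_V N \<gamma>)"

definition general_helix :: "real set \<Rightarrow> (real \<Rightarrow> real^3) \<Rightarrow> bool" where
  "general_helix I c \<longleftrightarrow> regular_curve I c \<and> constant_angle_on I (unit_tangent c)"

definition V_direction_curve ::
    "real set \<Rightarrow> (real^3) set \<Rightarrow> (real^3 \<Rightarrow> real^3) \<Rightarrow> (real \<Rightarrow> real^3) \<Rightarrow> (real \<Rightarrow> real^3) \<Rightarrow> bool" where
  "V_direction_curve I M N \<gamma> c \<longleftrightarrow>
     smooth_on I c \<and> c ` I \<subseteq> M \<and>
     (\<forall>s\<in>I. (c has_vector_derivative darboux_V N \<gamma> s) (at s))"

end

theory Submission
  imports Defs
begin

text \<open>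
  The unit tangent of the \<open>V\<close>-direction curve is the field \<open>V\<close> itself, so the two constant angle
  conditions are the same condition.  This rests on \<open>V\<close> having length one: \<open>V\<close> is the cross product
  of the unit vectors \<open>U\<close> and \<open>T\<close>, and these are orthogonal because \<open>T\<close> is tangent to the surface.
  It follows that the \<open>V\<close>-direction curve has unit speed, hence is regular and normalising its
  velocity changes nothing.

  In the definition of the tangent space a tangent vector is the velocity at parameter \<open>0\<close> of a
  smooth curve on a symmetric interval.  To see that the velocity of a curve on \<open>M\<close> at an arbitrary
  parameter \<open>s\<close> is tangent, the curve is translated in its parameter and restricted; the invariance
  of smoothness under these operations is \<open>Ck_on_shift\<close> and \<open>Ck_on_subset\<close>.
\<close>

lemma Ck_on_subset:
  assumes "Ck_on k S f" "T \<subseteq> S"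
  shows "Ck_on k T f"
  using assms by (induction k arbitrary: f) (auto intro: continuous_on_subset)

lemma has_derivative_shift:
  fixes f :: "'a::real_normed_vector \<Rightarrow> 'b::real_normed_vector"
  shows "((\<lambda>x. f (a + x)) has_derivative D) (at x) \<longleftrightarrow> (f has_derivative D) (at (a + x))"
proof
  assume "(f has_derivative D) (at (a + x))"
  moreover have "((\<lambda>x. a + x) has_derivative (\<lambda>h. h)) (at x)"
    by (auto intro!: derivative_eq_intros)
  ultimately show "((\<lambda>x. f (a + x)) has_derivative D) (at x)"
    using has_derivative_compose by blast
next
  assume D: "((\<lambda>x. f (a + x)) has_derivative D) (at x)"
  have "((\<lambda>y. y - a) has_derivative (\<lambda>h. h)) (at (a + x))"
    by (auto intro!: derivative_eq_intros)
  moreover have "((\<lambda>x. f (a + x)) has_derivative D) (at ((a + x) - a))"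
    using D by simp
  ultimately have "((\<lambda>y. f (a + (y - a))) has_derivative D) (at (a + x))"
    by (rule has_derivative_compose)
  then show "(f has_derivative D) (at (a + x))"
    by simp
qed

text \<open>
  The Frechet derivative commutes with translation at every point, differentiable or not, so the
  induction needs no congruence rule for functions that agree only on \<open>S\<close>.
\<close>

lemma Ck_on_shift:
  assumes "Ck_on k S f"
  shows "Ck_on k {x. a + x \<in> S} (\<lambda>x. f (a + x))"
  using assms
proof (induction k arbitrary: f)
  case 0
  then show ?case
    by (auto intro!: continuous_intros continuous_on_compose2[of S f])
next
  case (Suc k)
  have "frechet_derivative (\<lambda>x. f (a + x)) (at x) = frechet_derivative f (at (a + x))" for x
    by (simp add: frechet_derivative_def has_derivative_shift)
  moreover have "(\<lambda>x. f (a + x)) differentiable (at x)" if "a + x \<in> S" for x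
    using Suc.prems that by (auto simp: differentiable_def has_derivative_shift)
  moreover have "Ck_on k {x. a + x \<in> S} (\<lambda>x. frechet_derivative f (at (a + x)) v)" for v
    using Suc.prems Suc.IH[of "\<lambda>x. frechet_derivative f (at x) v"] by simp
  ultimately show ?case
    by simp
qed

lemma velocity_in_tangent_space:
  assumes "open I" "smooth_on I c" "c ` I \<subseteq> M" "s \<in> I"
  shows "vector_derivative c (at s) \<in> tangent_space M (c s)"
proof -
  obtain e where e: "e > 0" "ball s e \<subseteq> I"
    using assms openE by blast
  have sub: "{-e<..<e} \<subseteq> {x. s + x \<in> I}"
    using e(2) by (auto simp: subset_iff dist_real_def)
  have "smooth_on {-e<..<e} (\<lambda>x. c (s + x))"
    using assms(2) sub unfolding smooth_on_def by (blast intro: Ck_on_shift Ck_on_subset)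
  moreover have "(\<lambda>x. c (s + x)) ` {-e<..<e} \<subseteq> M"
    using sub assms(3) by blast
  moreover have "((\<lambda>x. c (s + x)) has_vector_derivative vector_derivative c (at s)) (at 0)"
  proof -
    have "Ck_on (Suc 0) I c"
      using assms(2) unfolding smooth_on_def by blast
    then have "c differentiable (at s)"
      using assms(4) by auto
    then have "(c has_vector_derivative vector_derivative c (at s)) (at s)"
      by (simp add: vector_derivative_works)
    then show ?thesis
      by (simp add: has_vector_derivative_def has_derivative_shift)
  qed
  ultimately show ?thesis
    unfolding tangent_space_def using e(1) by force
qed

lemma norm_darboux_V:
  assumes "oriented_surface M N" "unit_speed_curve I \<gamma>" "\<gamma> ` I \<subseteq> M" "s \<in> I"
  shows "norm (darboux_V N \<gamma> s) = 1"
proof -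
  have "darboux_T \<gamma> s \<in> tangent_space M (\<gamma> s)"
    using assms unfolding darboux_T_def unit_speed_curve_def regular_curve_def
    by (blast intro: velocity_in_tangent_space)
  then have "darboux_U N \<gamma> s \<bullet> darboux_T \<gamma> s = 0" "norm (darboux_U N \<gamma> s) = 1"
    using assms by (auto simp: oriented_surface_def darboux_U_def)
  moreover have "norm (darboux_T \<gamma> s) = 1"
    using assms by (simp add: unit_speed_curve_def darboux_T_def)
  ultimately have "(norm (darboux_V N \<gamma> s))\<^sup>2 = 1"
    unfolding darboux_V_def by (simp add: norm_cross)
  then show ?thesis
    using norm_ge_zero[of "darboux_V N \<gamma> s"] by (auto simp only: power2_eq_1_iff)
qed

theorem theorem3:
  fixes M :: "(real^3) set" and N :: "real^3 \<Rightarrow> real^3"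
    and I :: "real set" and \<gamma> \<gamma>bar :: "real \<Rightarrow> real^3"
  assumes "oriented_surface M N"
    and "unit_speed_curve I \<gamma>" and "\<gamma> ` I \<subseteq> M"
    and "V_direction_curve I M N \<gamma> \<gamma>bar"
  shows "relatively_normal_slant_helix I N \<gamma> \<longleftrightarrow> general_helix I \<gamma>bar"
proof -
  have velocity: "vector_derivative \<gamma>bar (at s) = darboux_V N \<gamma> s" if "s \<in> I" for s
    using assms(4) that by (auto simp: V_direction_curve_def intro: vector_derivative_at)
  have unit: "norm (darboux_V N \<gamma> s) = 1" if "s \<in> I" for s
    using norm_darboux_V assms that by blast
  have "unit_tangent \<gamma>bar s = darboux_V N \<gamma> s" if "s \<in> I" for s
    using that by (simp add: unit_tangent_def velocity unit)
  then have "constant_angle_on I (unit_tangent \<gamma>bar) \<longleftrightarrow> constant_angle_on I (darboux_V N \<gamma>)"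
    by (simp add: constant_angle_on_def)
  moreover have "regular_curve I \<gamma>bar"
    using assms(2,4) velocity unit
    by (force simp: regular_curve_def unit_speed_curve_def V_direction_curve_def)
  ultimately show ?thesis
    by (simp add: relatively_normal_slant_helix_def general_helix_def)
qed

end
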